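(* Let $H=-\partial_x^2-2\operatorname{sech}^2(x)$ on $\mathbb R$, which admits the zero energy resonance $\varphi(x)=\tanh(x)$, and let $\alpha(x)=\operatorname{sech}(x)\tanh(x)$. Then the distorted Fourier transform with respect to $H$ of $\alpha\varphi^2$ satisfies $$\widetilde{\mathcal F}[\alpha\varphi^2](\pm\sqrt3)=0.$$
   Context: For $\xi\in\mathbb R$ the Jost solutions $f_\pm(\cdot,\xi)$ of $H=-\partial_x^2+V$ are the unique solutions of $Hf_\pm(\cdot,\xi)=\xi^2f_\pm(\cdot,\xi)$ with $f_\pm(x,\xi)\sim e^{\pm ix\xi}$ as $x\to\pm\infty$. The transmission coefficient $T(\xi)$ is defined by $T(\xi)W(\xi)=-2i\xi$, with $W(\xi)=f_+\partial_xf_--f_-\partial_xf_+$ the Wronskian of $f_+(\cdot,\xi)$ and $f_-(\cdot,\xi)$. The distorted Fourier basis is $e(x,\xi)=\frac1{\sqrt{2\pi}}T(\xi)f_+(x,\xi)$ for $\xi\ge0$ and $e(x,\xi)=\frac1{\sqrt{2\pi}}T(-\xi)f_-(x,-\xi)$ for $\xi<0$, and $\widetilde{\mathcal F}[g](\xi)=\int_{\mathbb R}\overline{e(x,\xi)}\,g(x)\,dx$. *)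

theory Defs
  imports "HOL-Analysis.Analysis" "HOL-Library.Landau_Symbols"
begin

definition sech :: "real \<Rightarrow> real" where
  "sech x = 1 / cosh x"

definition schrodinger_op ::
  "(real \<Rightarrow> real) \<Rightarrow> (real \<Rightarrow> 'a::real_normed_vector) \<Rightarrow> real \<Rightarrow> 'a" where
  "schrodinger_op V f x =
     - vector_derivative (\<lambda>y. vector_derivative f (at y)) (at x) + V x *\<^sub>R f x"

text \<open>Classical solutions of \<open>H f = E f\<close>; the two differentiability conditions make the
  derivatives in \<^const>\<open>schrodinger_op\<close> meaningful.\<close>

definition solves_schrodinger ::
  "(real \<Rightarrow> real) \<Rightarrow> real \<Rightarrow> (real \<Rightarrow> 'a::real_normed_vector) \<Rightarrow> bool" where
  "solves_schrodinger V E f \<longleftrightarrow>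
     (\<forall>x. f differentiable (at x)) \<and>
     (\<forall>x. (\<lambda>y. vector_derivative f (at y)) differentiable (at x)) \<and>
     (\<forall>x. schrodinger_op V f x = E *\<^sub>R f x)"

text \<open>A zero energy resonance is a nontrivial bounded solution of \<open>H f = 0\<close>. For the
  short-range potentials considered here such a solution tends to nonzero constants
  at both ends, so it is never an eigenfunction.\<close>

definition zero_energy_resonance :: "(real \<Rightarrow> real) \<Rightarrow> (real \<Rightarrow> real) \<Rightarrow> bool" where
  "zero_energy_resonance V f \<longleftrightarrow>
     solves_schrodinger V 0 f \<and> bounded (range f) \<and> (\<exists>x. f x \<noteq> 0)"

definition jost_plus :: "(real \<Rightarrow> real) \<Rightarrow> real \<Rightarrow> real \<Rightarrow> complex" where
  "jost_plus V \<xi> = (THE f. solves_schrodinger V (\<xi>\<^sup>2) f \<and>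
     asymp_equiv f at_top (\<lambda>x. exp (\<i> * of_real (x * \<xi>))))"

definition jost_minus :: "(real \<Rightarrow> real) \<Rightarrow> real \<Rightarrow> real \<Rightarrow> complex" where
  "jost_minus V \<xi> = (THE f. solves_schrodinger V (\<xi>\<^sup>2) f \<and>
     asymp_equiv f at_bot (\<lambda>x. exp (- \<i> * of_real (x * \<xi>))))"

text \<open>The Wronskian of two solutions with the same energy does not depend on the point;
  it is evaluated at \<open>0\<close>.\<close>

definition jost_wronskian :: "(real \<Rightarrow> real) \<Rightarrow> real \<Rightarrow> complex" where
  "jost_wronskian V \<xi> =
     jost_plus V \<xi> 0 * vector_derivative (jost_minus V \<xi>) (at 0)
     - jost_minus V \<xi> 0 * vector_derivative (jost_plus V \<xi>) (at 0)"

text \<open>The solution \<open>T\<close> of \<open>T(\<xi>) W(\<xi>) = - 2 \<i> \<xi>\<close>. For real \<open>\<xi> \<noteq> 0\<close> the Wronskian does not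
  vanish. At \<open>\<xi> = 0\<close> in the presence of a resonance the equation reads \<open>0 = 0\<close> and division
  by zero yields \<open>T(0) = 0\<close> rather than the continuous extension.\<close>

definition transmission :: "(real \<Rightarrow> real) \<Rightarrow> real \<Rightarrow> complex" where
  "transmission V \<xi> = (- 2 * \<i> * of_real \<xi>) / jost_wronskian V \<xi>"

definition distorted_basis :: "(real \<Rightarrow> real) \<Rightarrow> real \<Rightarrow> real \<Rightarrow> complex" where
  "distorted_basis V x \<xi> =
     (if \<xi> \<ge> 0
      then of_real (1 / sqrt (2 * pi)) * transmission V \<xi> * jost_plus V \<xi> x
      else of_real (1 / sqrt (2 * pi)) * transmission V (- \<xi>) * jost_minus V (- \<xi>) x)"

definition distorted_fourier ::
  "(real \<Rightarrow> real) \<Rightarrow> (real \<Rightarrow> complex) \<Rightarrow> real \<Rightarrow> complex" where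
  "distorted_fourier V g \<xi> = (LINT x|lborel. cnj (distorted_basis V x \<xi>) * g x)"

end

theory Submission imports Defs "HOL-Computational_Algebra.Polynomial" "HOL-Real_Asymp.Real_Asymp" begin

text \<open>The potential is reflectionless: \<open>(tanh x - \<i> k) exp (\<i> k x)\<close> is an exact solution at
  energy \<open>k\<^sup>2\<close>, so up to constants it is both Jost solutions (with \<open>k = \<xi>\<close> and \<open>k = - \<xi>\<close>).
  For \<open>k\<^sup>2 = 3\<close>, and only then, the integrand \<open>(t + \<i> k) s t\<^sup>3 exp (- \<i> k x)\<close>, with \<open>t = tanh x\<close>
  and \<open>s = sech x\<close>, has a primitive \<open>s P(t) exp (- \<i> k x)\<close> with \<open>P\<close> a polynomial, and it
  vanishes at both ends.\<close>

section \<open>Identities, derivatives and bounds for \<open>sech\<close> and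
  \<open>tanh\<close>\<close>

lemma sech_nonneg: "0 \<le> sech x"
  by (simp add: sech_def)

lemma sech_squared: "(sech x)\<^sup>2 = 1 - (tanh x)\<^sup>2"
proof -
  have "(sech x)\<^sup>2 + (tanh x)\<^sup>2 = ((sinh x)\<^sup>2 + 1) / (cosh x)\<^sup>2"
    by (simp add: sech_def tanh_def power_divide add_divide_distrib)
  also have "\<dots> = 1" by (simp flip: cosh_square_eq)
  finally show ?thesis by simp
qed

lemma has_real_derivative_tanh:
  "(tanh has_real_derivative 1 - (tanh x)\<^sup>2) (at x)"
  by (rule derivative_eq_intros refl | simp)+

lemma has_real_derivative_sech:
  "(sech has_real_derivative - sech x * tanh x) (at x)"
  unfolding sech_def [abs_def]
  by (rule derivative_eq_intros refl | simp add: tanh_def power2_eq_square)+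

lemma abs_tanh_le_1: "\<bar>tanh x\<bar> \<le> (1::real)"
  using tanh_real_lt_1[of x] tanh_real_gt_neg1[of x] by linarith

section \<open>Plane waves and their oscillation at infinity\<close>

definition plane_wave :: "real \<Rightarrow> real \<Rightarrow> complex" where
  "plane_wave k x = exp (\<i> * of_real (x * k))"

lemma norm_plane_wave [simp]: "norm (plane_wave k x) = 1"
  by (simp add: plane_wave_def)

lemma plane_wave_nonzero [simp]: "plane_wave k x \<noteq> 0"
  by (simp add: plane_wave_def)

lemma plane_wave_mult: "plane_wave k x * plane_wave l x = plane_wave (k + l) x"
  by (simp add: plane_wave_def flip: exp_add) (simp add: algebra_simps)

lemma cnj_plane_wave: "cnj (plane_wave k x) = plane_wave (- k) x"
  by (simp add: plane_wave_def exp_cnj)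

lemma has_vector_derivative_plane_wave:
  "(plane_wave k has_vector_derivative \<i> * of_real k * plane_wave k x) (at x)"
proof -
  have "((\<lambda>z. exp (\<i> * (z * of_real k))) has_field_derivative
      \<i> * of_real k * plane_wave k x) (at (of_real x))"
    by (rule derivative_eq_intros refl | simp add: plane_wave_def)+
  from has_vector_derivative_real_field[OF this] show ?thesis
    by (simp add: plane_wave_def [abs_def])
qed

lemma has_vector_derivative_times_plane_wave:
  assumes "(p has_vector_derivative p') (at x)"
  shows "((\<lambda>x. p x * plane_wave k x) has_vector_derivative
           (p' + \<i> * of_real k * p x) * plane_wave k x) (at x)"
  using has_vector_derivative_mult[OF assms has_vector_derivative_plane_wave[of k x]]
  by (simp add: algebra_simps)

text \<open>A shift by half a period, \<open>pi / k\<close>, flips the sign, so a limit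
  \<open>c\<close> would satisfy c = -c; but c = 0 contradicts norm 1. Shift invariance of
  \<open>F\<close> is the only property of the two infinities that this uses besides
  \<open>F \<noteq> bot\<close>, so one argument serves both ends.\<close>

lemma plane_wave_diverges:
  assumes "k \<noteq> 0" and "F \<noteq> bot" and "\<And>a. filterlim (\<lambda>x. x + a) F F"
  shows "\<not> (plane_wave k \<longlongrightarrow> c) F"
proof
  assume lim: "(plane_wave k \<longlongrightarrow> c) F"
  from filterlim_compose[OF this assms(3)]
  have "((\<lambda>x. plane_wave k (x + pi / k)) \<longlongrightarrow> c) F" .
  moreover have "plane_wave k (x + pi / k) = - plane_wave k x" for x
  proof -
    have "\<i> * of_real ((x + pi / k) * k) = \<i> * of_real (x * k) + of_real pi * \<i>"
      using \<open>k \<noteq> 0\<close> by (simp add: field_simps flip: of_real_mult)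
    then show ?thesis
      unfolding plane_wave_def by (simp add: exp_add)
  qed
  ultimately have "((\<lambda>x. - plane_wave k x) \<longlongrightarrow> c) F" by simp
  with tendsto_minus[OF lim] have "c = - c"
    using \<open>F \<noteq> bot\<close> tendsto_unique by blast
  then have "c = 0" by simp
  with tendsto_norm[OF lim] have "((\<lambda>x. 1 :: real) \<longlongrightarrow> 0) F" by simp
  then show False using \<open>F \<noteq> bot\<close> by (simp add: tendsto_const_iff)
qed

section \<open>The Schrodinger equation as a first order system, and Wronskians\<close>

lemma solves_schrodingerI:
  assumes "\<And>x. (f has_vector_derivative f' x) (at x)"
    and "\<And>x. (f' has_vector_derivative f'' x) (at x)"
    and "\<And>x. - f'' x + V x *\<^sub>R f x = E *\<^sub>R f x"
  shows "solves_schrodinger V E f"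
proof -
  have "(\<lambda>y. vector_derivative f (at y)) = f'"
    using assms(1) by (auto intro: vector_derivative_at)
  then show ?thesis
    using assms vector_derivative_at[OF assms(2)]
    by (auto simp: solves_schrodinger_def schrodinger_op_def
        intro: differentiableI_vector)
qed

lemma solves_schrodingerE:
  assumes "solves_schrodinger V E f"
  obtains f' where "\<And>x. (f has_vector_derivative f' x) (at x)"
    and "\<And>x. (f' has_vector_derivative V x *\<^sub>R f x - E *\<^sub>R f x) (at x)"
proof
  let ?f' = "\<lambda>y. vector_derivative f (at y)"
  show "(f has_vector_derivative ?f' x) (at x)" for x
    using assms by (simp add: solves_schrodinger_def vector_derivative_works)
  have "V x *\<^sub>R f x - E *\<^sub>R f x = vector_derivative ?f' (at x)" for x
    using assms by (simp add: solves_schrodinger_def schrodinger_op_def algebra_simps)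
  then show "(?f' has_vector_derivative V x *\<^sub>R f x - E *\<^sub>R f x) (at x)" for x
    using assms by (simp add: solves_schrodinger_def vector_derivative_works)
qed

text \<open>In the derivative the products f' g' cancel, and f g'' - f'' g vanishes because both
  second derivatives carry the same factor V - E.\<close>

lemma wronskian_constant:
  fixes f g :: "real \<Rightarrow> complex"
  assumes "\<And>x. (f has_vector_derivative f' x) (at x)"
    and "\<And>x. (f' has_vector_derivative V x *\<^sub>R f x - E *\<^sub>R f x) (at x)"
    and "\<And>x. (g has_vector_derivative g' x) (at x)"
    and "\<And>x. (g' has_vector_derivative V x *\<^sub>R g x - E *\<^sub>R g x) (at x)"
  obtains c where "\<And>x. f x * g' x - f' x * g x = c"
proof -
  have "((\<lambda>x. f x * g' x - f' x * g x) has_vector_derivative 0) (at x)" for x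
    using has_vector_derivative_diff[OF
        has_vector_derivative_mult[OF assms(1) assms(4)]
        has_vector_derivative_mult[OF assms(2) assms(3)], of x]
    by (simp add: algebra_simps)
  then have "\<And>x. x \<in> UNIV \<Longrightarrow>
      ((\<lambda>x. f x * g' x - f' x * g x) has_vector_derivative 0) (at x within UNIV)"
    by simp
  from has_vector_derivative_zero_constant[OF convex_UNIV this] that
  show thesis by auto
qed

section \<open>Explicit solutions for the potential -2 sech^2\<close>

definition tanh_wave :: "real \<Rightarrow> real \<Rightarrow> complex" where
  "tanh_wave k x = (of_real (tanh x) - \<i> * of_real k) * plane_wave k x"

definition tanh_wave_deriv :: "real \<Rightarrow> real \<Rightarrow> complex" where
  "tanh_wave_deriv k x =
     (1 - of_real (tanh x)^2 + \<i> * of_real k * (of_real (tanh x) - \<i> * of_real k)) * plane_wave k x"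

lemma has_vector_derivative_of_real_tanh:
  "((\<lambda>x. complex_of_real (tanh x)) has_vector_derivative 1 - (of_real (tanh x))\<^sup>2) (at x)"
  using has_vector_derivative_of_real[OF has_real_derivative_tanh[of x]]
  by simp

lemma has_vector_derivative_of_real_sech:
  "((\<lambda>x. complex_of_real (sech x)) has_vector_derivative
     - of_real (sech x) * of_real (tanh x)) (at x)"
  using has_vector_derivative_of_real[OF has_real_derivative_sech[of x]]
  by simp

text \<open>Because tanh' = 1 - tanh^2, polynomials in tanh are closed under differentiation. The
  calculus below thereby becomes polynomial algebra with \<open>pderiv\<close>.\<close>

lemma has_vector_derivative_poly_of_real_tanh:
  "((\<lambda>x. poly p (complex_of_real (tanh x))) has_vector_derivative
     (1 - (of_real (tanh x))\<^sup>2) * poly (pderiv p) (of_real (tanh x))) (at x)"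
  using field_vector_diff_chain_at[OF has_vector_derivative_of_real_tanh[of x] poly_DERIV[of p]]
  by (simp add: o_def)

lemma has_vector_derivative_tanh_wave:
  "(tanh_wave k has_vector_derivative tanh_wave_deriv k x) (at x)"
  using has_vector_derivative_times_plane_wave[OF
      has_vector_derivative_poly_of_real_tanh[of "[:- \<i> * of_real k, 1:]" x], of k]
  by (simp add: tanh_wave_def [abs_def] tanh_wave_deriv_def pderiv_pCons)

text \<open>Behind this is a Darboux transformation: with A = d/dx + tanh and A* = -d/dx + tanh one
  has A* A = H + 1 and A A* = -d^2/dx^2 + 1. Hence A* maps free solutions to solutions of H with the
  same energy, and \<open>tanh_wave k\<close> is A* applied to \<open>plane_wave k\<close>. The
  proof checks the result directly, as an identity of polynomials in tanh.\<close>

lemma has_vector_derivative_tanh_wave_deriv: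
  "(tanh_wave_deriv k has_vector_derivative
     (- 2 * (sech x)\<^sup>2) *\<^sub>R tanh_wave k x - k\<^sup>2 *\<^sub>R tanh_wave k x) (at x)"
proof -
  let ?t = "complex_of_real (tanh x)"
  let ?p = "[:1 + of_real k ^ 2, \<i> * of_real k, -1:]"
  have "tanh_wave_deriv k = (\<lambda>x. poly ?p (of_real (tanh x)) * plane_wave k x)"
    by (auto simp: tanh_wave_deriv_def algebra_simps power2_eq_square)
  moreover have "(1 - ?t\<^sup>2) * poly (pderiv ?p) ?t + \<i> * of_real k * poly ?p ?t
      = (- 2 * (1 - ?t\<^sup>2) - of_real k ^ 2) * (?t - \<i> * of_real k)"
    by (simp add: pderiv_pCons algebra_simps power2_eq_square)
  moreover have "(- 2 * (sech x)\<^sup>2) *\<^sub>R tanh_wave k x - k\<^sup>2 *\<^sub>R tanh_wave k x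
      = (- 2 * (1 - ?t\<^sup>2) - of_real k ^ 2) * (?t - \<i> * of_real k) * plane_wave k x"
    by (simp add: sech_squared scaleR_conv_of_real tanh_wave_def algebra_simps)
  ultimately show ?thesis
    using has_vector_derivative_times_plane_wave[OF
        has_vector_derivative_poly_of_real_tanh[of ?p x], of k]
    by simp
qed

lemma solves_schrodinger_tanh_wave:
  "solves_schrodinger (\<lambda>x. - 2 * (sech x)\<^sup>2) (k\<^sup>2) (\<lambda>x. c * tanh_wave k x)"
proof (rule solves_schrodingerI)
  show "((\<lambda>x. c * tanh_wave k x) has_vector_derivative c * tanh_wave_deriv k x) (at x)" for x
    by (intro has_vector_derivative_mult_right has_vector_derivative_tanh_wave)
  show "((\<lambda>x. c * tanh_wave_deriv k x) has_vector_derivative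
      c * ((- 2 * (sech x)\<^sup>2) *\<^sub>R tanh_wave k x - k\<^sup>2 *\<^sub>R tanh_wave k x)) (at x)" for x
    by (intro has_vector_derivative_mult_right has_vector_derivative_tanh_wave_deriv)
qed (simp add: algebra_simps)

text \<open>A solution is a combination of \<open>tanh_wave k\<close> and \<open>tanh_wave (- k)\<close> with Wronskians
  as coefficients.\<close>

lemma solution_eq_tanh_waves:
  assumes "solves_schrodinger (\<lambda>x. - 2 * (sech x)\<^sup>2) (k\<^sup>2) f" and "k \<noteq> 0"
  obtains a b where "\<And>x. f x = a * tanh_wave k x + b * tanh_wave (- k) x"
proof -
  obtain f' where f': "\<And>x. (f has_vector_derivative f' x) (at x)"
      "\<And>x. (f' has_vector_derivative (- 2 * (sech x)\<^sup>2) *\<^sub>R f x - k\<^sup>2 *\<^sub>R f x) (at x)"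
    using solves_schrodingerE[OF assms(1)] by metis
  let ?u = "tanh_wave k" and ?u' = "tanh_wave_deriv k"
  let ?v = "tanh_wave (- k)" and ?v' = "tanh_wave_deriv (- k)"
  note u = has_vector_derivative_tanh_wave[of k] has_vector_derivative_tanh_wave_deriv[of k]
  have v: "\<And>x. (?v has_vector_derivative ?v' x) (at x)"
    "\<And>x. (?v' has_vector_derivative (- 2 * (sech x)\<^sup>2) *\<^sub>R ?v x - k\<^sup>2 *\<^sub>R ?v x) (at x)"
    using has_vector_derivative_tanh_wave[of "- k"] has_vector_derivative_tanh_wave_deriv[of "- k"]
    by simp_all
  obtain p where p: "\<And>x. f x * ?v' x - f' x * ?v x = p"
    using wronskian_constant[OF f' v] by metis
  obtain q where q: "\<And>x. f x * ?u' x - f' x * ?u x = q"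
    using wronskian_constant[OF f' u] by metis
  obtain w where w: "\<And>x. ?u x * ?v' x - ?u' x * ?v x = w"
    using wronskian_constant[OF u v] by metis
  \<comment> \<open>The constant Wronskian is read off at 0, where tanh vanishes and both plane
    waves equal 1.\<close>
  have "w = - 2 * \<i> * of_real k * (1 + of_real k ^ 2)"
  proof -
    have "\<i> * (\<i> * z) = - z" for z
      by (simp flip: mult.assoc)
    then show ?thesis
      unfolding w[of 0, symmetric]
      by (simp add: tanh_wave_def tanh_wave_deriv_def plane_wave_def algebra_simps power2_eq_square)
  qed
  moreover have "1 + of_real k ^ 2 \<noteq> (0 :: complex)"
  proof -
    have "1 + k\<^sup>2 \<noteq> 0" by (smt (verit) zero_le_power2)
    then show ?thesis by (metis of_real_1 of_real_add of_real_eq_0_iff of_real_power)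
  qed
  ultimately have "w \<noteq> 0" using \<open>k \<noteq> 0\<close> by simp
  \<comment> \<open>Cramer's rule: f (u v' - u' v) = (f v' - f' v) u - (f u' - f' u) v, an identity
    in the six values.\<close>
  have "f x * w = p * ?u x - q * ?v x" for x
    unfolding w[of x, symmetric] p[of x, symmetric] q[of x, symmetric] by algebra
  then have "f x = (p / w) * ?u x + (- q / w) * ?v x" for x
    using \<open>w \<noteq> 0\<close> by (simp add: field_simps)
  then show thesis using that by blast
qed

section \<open>Jost solutions and the distorted basis\<close>

lemma tanh_wave_unique:
  assumes f: "solves_schrodinger (\<lambda>x. - 2 * (sech x)\<^sup>2) (k\<^sup>2) f" and "k \<noteq> 0"
    and lim: "asymp_equiv f F (plane_wave k)"
    and F: "F \<noteq> bot" "\<And>a. filterlim (\<lambda>x. x + a) F F"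
    and tanh: "(tanh \<longlongrightarrow> \<sigma>) F"
  shows "f = (\<lambda>x. 1 / (of_real \<sigma> - \<i> * of_real k) * tanh_wave k x)"
proof -
  obtain a b where ab: "\<And>x. f x = a * tanh_wave k x + b * tanh_wave (- k) x"
    using solution_eq_tanh_waves[OF f \<open>k \<noteq> 0\<close>] by metis
  \<comment> \<open>The imaginary parts are k and -k, so these factors vanish neither at the values
    of tanh nor at its limit \<sigma>.\<close>
  have nz: "of_real s + \<i> * of_real k \<noteq> 0" "of_real s - \<i> * of_real k \<noteq> 0" for s
    using \<open>k \<noteq> 0\<close> by (auto simp: complex_eq_iff)
  have t: "((\<lambda>x. complex_of_real (tanh x)) \<longlongrightarrow> of_real \<sigma>) F"
    using tanh by (intro tendsto_of_real)
  \<comment> \<open>Since \<open>plane_wave\<close> has no zeros, the 0/0 convention in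
    \<open>asymp_equiv\<close> never applies and the relation is plain convergence of the
    quotient.\<close>
  have "((\<lambda>x. f x / plane_wave k x) \<longlongrightarrow> 1) F"
    using lim by (simp add: asymp_equiv_def)
  \<comment> \<open>The quotient splits into a term that converges with tanh and one that oscillates
    with frequency -2k. The latter forces b = 0, and the limit of the former then fixes a.\<close>
  moreover have "f x / plane_wave k x = a * (of_real (tanh x) - \<i> * of_real k)
      + b * (of_real (tanh x) + \<i> * of_real k) * plane_wave (- 2 * k) x" for x
  proof -
    have "plane_wave (- k) x = plane_wave (- 2 * k) x * plane_wave k x"
      by (simp add: plane_wave_mult)
    then show ?thesis
      by (simp add: ab tanh_wave_def field_simps)
  qed
  ultimately have l: "((\<lambda>x. a * (of_real (tanh x) - \<i> * of_real k)
      + b * (of_real (tanh x) + \<i> * of_real k) * plane_wave (- 2 * k) x) \<longlongrightarrow> 1) F"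
    by simp
  have "b = 0"
  proof (rule ccontr)
    assume "b \<noteq> 0"
    let ?d = "\<lambda>z. b * (z + \<i> * of_real k)"
    \<comment> \<open>Solving the expression for its oscillating factor would give that factor a
      limit.\<close>
    have "((\<lambda>x. ((a * (of_real (tanh x) - \<i> * of_real k)
      + ?d (of_real (tanh x)) * plane_wave (- 2 * k) x)
      - a * (of_real (tanh x) - \<i> * of_real k)) / ?d (of_real (tanh x)))
      \<longlongrightarrow> (1 - a * (of_real \<sigma> - \<i> * of_real k)) / ?d (of_real \<sigma>)) F"
      using nz \<open>b \<noteq> 0\<close> by (intro tendsto_intros l t) auto
    then have "(plane_wave (- 2 * k) \<longlongrightarrow>
        (1 - a * (of_real \<sigma> - \<i> * of_real k)) / ?d (of_real \<sigma>)) F"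
      using nz \<open>b \<noteq> 0\<close> by simp
    then show False
      using plane_wave_diverges[of "- 2 * k" F] F \<open>k \<noteq> 0\<close> by auto
  qed
  with l have "((\<lambda>x. a * (of_real (tanh x) - \<i> * of_real k)) \<longlongrightarrow> 1) F" by simp
  moreover have "((\<lambda>x. a * (of_real (tanh x) - \<i> * of_real k)) \<longlongrightarrow>
      a * (of_real \<sigma> - \<i> * of_real k)) F"
    by (intro tendsto_intros t)
  ultimately have "a * (of_real \<sigma> - \<i> * of_real k) = 1"
    using F(1) tendsto_unique by blast
  then have "a = 1 / (of_real \<sigma> - \<i> * of_real k)"
    using nz by (simp add: field_simps)
  with ab \<open>b = 0\<close> show ?thesis by auto
qed

lemma asymp_equiv_tanh_wave:
  assumes "k \<noteq> 0" and "(tanh \<longlongrightarrow> \<sigma>) F"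
  shows "asymp_equiv (\<lambda>x. 1 / (of_real \<sigma> - \<i> * of_real k) * tanh_wave k x) F (plane_wave k)"
proof -
  have nz: "of_real \<sigma> - \<i> * of_real k \<noteq> 0"
    using \<open>k \<noteq> 0\<close> by (auto simp: complex_eq_iff)
  have "((\<lambda>x. (of_real (tanh x) - \<i> * of_real k) / (of_real \<sigma> - \<i> * of_real k)) \<longlongrightarrow>
      (of_real \<sigma> - \<i> * of_real k) / (of_real \<sigma> - \<i> * of_real k)) F"
    using nz by (intro tendsto_intros tendsto_of_real assms)
  then show ?thesis
    using nz by (simp add: asymp_equiv_def tanh_wave_def del: right_minus_eq)
qed

text \<open>Existence and uniqueness together evaluate the definite description. The general filter
  covers both normalizations: \<sigma> = 1 at \<open>at_top\<close> and \<sigma> = -1 at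
  \<open>at_bot\<close>.\<close>

lemma the_jost_solution:
  assumes "k \<noteq> 0" and "F \<noteq> bot" and "\<And>a. filterlim (\<lambda>x. x + a) F F"
    and "(tanh \<longlongrightarrow> \<sigma>) F"
  shows "(THE f. solves_schrodinger (\<lambda>x. - 2 * (sech x)\<^sup>2) (k\<^sup>2) f \<and>
      asymp_equiv f F (plane_wave k))
    = (\<lambda>x. 1 / (of_real \<sigma> - \<i> * of_real k) * tanh_wave k x)"
  by (rule the_equality)
    (use assms tanh_wave_unique asymp_equiv_tanh_wave solves_schrodinger_tanh_wave in blast)+

lemma jost_plus_sech:
  assumes "k \<noteq> 0"
  shows "jost_plus (\<lambda>x. - 2 * (sech x)\<^sup>2) k
    = (\<lambda>x. 1 / (1 - \<i> * of_real k) * tanh_wave k x)"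
proof -
  have "filterlim (\<lambda>x. x + a) at_top at_top" for a :: real
    by real_asymp
  moreover have "(tanh \<longlongrightarrow> (1::real)) at_top"
    by (rule tanh_real_at_top)
  ultimately have "(THE f. solves_schrodinger (\<lambda>x. - 2 * (sech x)\<^sup>2) (k\<^sup>2) f \<and>
      asymp_equiv f at_top (plane_wave k))
    = (\<lambda>x. 1 / (of_real 1 - \<i> * of_real k) * tanh_wave k x)"
    using assms by (intro the_jost_solution) auto
  then show ?thesis
    by (simp add: jost_plus_def plane_wave_def [abs_def])
qed

text \<open>The left Jost solution behaves like exp(-i k x), so the general result is used with -k;
  the energy is unchanged because (-k)^2 = k^2.\<close>

lemma jost_minus_sech:
  assumes "k \<noteq> 0"
  shows "jost_minus (\<lambda>x. - 2 * (sech x)\<^sup>2) k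
    = (\<lambda>x. 1 / (- 1 + \<i> * of_real k) * tanh_wave (- k) x)"
proof -
  have "filterlim (\<lambda>x. x + a) at_bot at_bot" for a :: real
    by real_asymp
  moreover have "(tanh \<longlongrightarrow> (- 1::real)) at_bot"
    by (rule tanh_real_at_bot)
  ultimately have "(THE f. solves_schrodinger (\<lambda>x. - 2 * (sech x)\<^sup>2) ((- k)\<^sup>2) f \<and>
      asymp_equiv f at_bot (plane_wave (- k)))
    = (\<lambda>x. 1 / (of_real (- 1) - \<i> * of_real (- k)) * tanh_wave (- k) x)"
    using assms by (intro the_jost_solution) auto
  then show ?thesis
    by (simp add: jost_minus_def plane_wave_def [abs_def])
qed

text \<open>For negative \<xi> the basis uses the left Jost solution at -\<xi>, which is again a
  multiple of \<open>tanh_wave \<xi>\<close>: no reflected wave appears. The transmission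
  coefficient and the Jost normalization are absorbed into \<open>c\<close>.\<close>

lemma distorted_basis_sech:
  assumes "\<xi> \<noteq> 0"
  obtains c where "\<And>x. distorted_basis (\<lambda>x. - 2 * (sech x)\<^sup>2) x \<xi> = c * tanh_wave \<xi> x"
proof (cases "\<xi> \<ge> 0")
  case True
  then show thesis
    by (intro that[of "of_real (1 / sqrt (2 * pi)) * transmission (\<lambda>x. - 2 * (sech x)\<^sup>2) \<xi>
          * (1 / (1 - \<i> * of_real \<xi>))"])
      (simp only: distorted_basis_def jost_plus_sech[OF assms] if_True mult.assoc)
next
  case False
  show thesis
    by (rule that[of "of_real (1 / sqrt (2 * pi)) * transmission (\<lambda>x. - 2 * (sech x)\<^sup>2) (- \<xi>)
          * (1 / (- 1 + \<i> * of_real (- \<xi>)))"])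
      (use False in \<open>simp add: distorted_basis_def jost_minus_sech [simplified]\<close>)
qed

section \<open>Integrability, decay, and integrals of exact derivatives\<close>

lemma integrable_sech: "integrable lborel sech"
proof -
  have "set_integrable lborel (einterval (-\<infinity>) \<infinity>) sech"
  proof (rule interval_integral_FTC_nonneg)
    \<comment> \<open>The primitive is the Gudermannian function; its finite limits give
      integrability because \<open>sech\<close> is nonnegative.\<close>
    show "((\<lambda>x. arctan (sinh x)) has_real_derivative sech x) (at x)" for x
    proof -
      have "1 + (sinh x)\<^sup>2 = (cosh x)\<^sup>2" by (simp add: cosh_square_eq)
      then show ?thesis
        by (auto intro!: derivative_eq_intros simp: sech_def power2_eq_square field_simps)
    qed
    show "isCont sech x" for x
      using has_real_derivative_sech DERIV_isCont by blast
    show "(((\<lambda>x. arctan (sinh x)) \<circ> real_of_ereal) \<longlongrightarrow> - pi / 2) (at_right (- \<infinity>))"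
      unfolding ereal_tendsto_simps by real_asymp
    show "(((\<lambda>x. arctan (sinh x)) \<circ> real_of_ereal) \<longlongrightarrow> pi / 2) (at_left \<infinity>)"
      unfolding ereal_tendsto_simps by real_asymp
  qed (auto simp: sech_nonneg)
  then show ?thesis by (simp add: set_integrable_def)
qed

lemma integral_by_decaying_primitive:
  fixes f F :: "real \<Rightarrow> complex"
  assumes "\<And>x. (F has_vector_derivative f x) (at x)" and "\<And>x. isCont f x"
    and "integrable lborel f" and "(F \<longlongrightarrow> 0) at_top" and "(F \<longlongrightarrow> 0) at_bot"
  shows "(LINT x|lborel. f x) = 0"
proof -
  have "(LBINT x=-\<infinity>..\<infinity>. f x) = 0 - 0"
  proof (rule interval_integral_FTC_integrable)
    show "((F \<circ> real_of_ereal) \<longlongrightarrow> 0) (at_right (- \<infinity>))"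
      unfolding ereal_tendsto_simps by (rule assms)
    show "((F \<circ> real_of_ereal) \<longlongrightarrow> 0) (at_left \<infinity>)"
      unfolding ereal_tendsto_simps by (rule assms)
  qed (use assms in \<open>auto simp: set_integrable_def\<close>)
  then show ?thesis
    by (simp add: interval_lebesgue_integral_def set_lebesgue_integral_def)
qed

text \<open>The values of tanh lie in the closed unit disc, whose image under a polynomial is
  compact.\<close>

lemma bounded_poly_of_real_tanh:
  "bounded (range (\<lambda>x. poly p (complex_of_real (tanh x))))"
proof (rule bounded_subset)
  show "bounded (poly p ` cball 0 1)"
    by (intro compact_imp_bounded compact_continuous_image continuous_intros compact_cball)
  show "range (\<lambda>x. poly p (complex_of_real (tanh x))) \<subseteq> poly p ` cball 0 1"
    using abs_tanh_le_1 by auto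
qed

text \<open>Domination by a multiple of \<open>sech\<close> yields both the integrability of these
  functions and their decay at the two ends.\<close>

lemma norm_sech_poly_tanh_le:
  obtains B where "\<And>x. norm (of_real (sech x) * poly p (complex_of_real (tanh x)) * plane_wave k x)
    \<le> B * sech x"
proof -
  obtain B where "\<And>x. norm (poly p (complex_of_real (tanh x))) \<le> B"
    using bounded_poly_of_real_tanh[of p] by (auto simp: bounded_iff)
  then have "norm (of_real (sech x) * poly p (complex_of_real (tanh x)) * plane_wave k x)
    \<le> B * sech x" for x
    using mult_right_mono[OF _ sech_nonneg, of "norm (poly p (complex_of_real (tanh x)))" B x]
    by (simp add: norm_mult sech_nonneg mult.commute)
  then show thesis using that by blast
qed

text \<open>Functions s P(t) exp(i k x) are closed under differentiation, which acts on P by P -> (1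
  - t^2) P' + (i k - t) P. Finding a primitive in this class is thus a linear problem for the
  coefficients of P.\<close>

lemma has_vector_derivative_sech_poly_tanh:
  "((\<lambda>x. of_real (sech x) * poly p (complex_of_real (tanh x)) * plane_wave k x)
     has_vector_derivative of_real (sech x) *
       poly ([:1, 0, - 1:] * pderiv p + [:\<i> * of_real k, - 1:] * p) (of_real (tanh x))
       * plane_wave k x) (at x)"
  using has_vector_derivative_times_plane_wave[OF has_vector_derivative_mult[OF
      has_vector_derivative_of_real_sech has_vector_derivative_poly_of_real_tanh[of p x]], of k]
  by (simp add: algebra_simps power2_eq_square)

lemma isCont_sech_poly_tanh:
  "isCont (\<lambda>x. of_real (sech x) * poly p (complex_of_real (tanh x)) * plane_wave k x) x"
  using has_vector_derivative_continuous[OF has_vector_derivative_sech_poly_tanh] .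

lemma integrable_sech_poly_tanh:
  "integrable lborel (\<lambda>x. of_real (sech x) * poly p (complex_of_real (tanh x)) * plane_wave k x)"
proof -
  obtain B where B:
    "\<And>x. norm (of_real (sech x) * poly p (complex_of_real (tanh x)) * plane_wave k x) \<le> B * sech x"
    using norm_sech_poly_tanh_le[of p k] by metis
  show ?thesis
  proof (rule Bochner_Integration.integrable_bound)
    show "integrable lborel (\<lambda>x. B * sech x)"
      using integrable_sech by simp
    show "(\<lambda>x. of_real (sech x) * poly p (complex_of_real (tanh x)) * plane_wave k x)
        \<in> borel_measurable lborel"
      using isCont_sech_poly_tanh
      by (auto intro!: borel_measurable_continuous_onI continuous_at_imp_continuous_on)
    show "AE x in lborel.
        norm (of_real (sech x) * poly p (complex_of_real (tanh x)) * plane_wave k x)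
        \<le> norm (B * sech x)"
      using B by (intro AE_I2) (smt (verit) real_norm_def)
  qed
qed

lemma tendsto_sech_poly_tanh:
  assumes "(sech \<longlongrightarrow> 0) F"
  shows "((\<lambda>x. of_real (sech x) * poly p (complex_of_real (tanh x)) * plane_wave k x) \<longlongrightarrow> 0) F"
proof -
  obtain B where B:
    "\<And>x. norm (of_real (sech x) * poly p (complex_of_real (tanh x)) * plane_wave k x) \<le> B * sech x"
    using norm_sech_poly_tanh_le[of p k] by metis
  show ?thesis
    by (rule Lim_null_comparison[where g = "\<lambda>x. B * sech x"])
      (use B assms tendsto_mult_right_zero in auto)
qed

lemma integral_sech_poly_tanh_exact:
  "(LINT x|lborel. of_real (sech x) *
     poly ([:1, 0, - 1:] * pderiv p + [:\<i> * of_real k, - 1:] * p) (complex_of_real (tanh x))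
     * plane_wave k x) = 0"
proof (rule integral_by_decaying_primitive)
  have "(sech \<longlongrightarrow> 0) at_top" "(sech \<longlongrightarrow> 0) at_bot"
    unfolding sech_def [abs_def] by real_asymp+
  then show "((\<lambda>x. of_real (sech x) * poly p (complex_of_real (tanh x)) * plane_wave k x)
      \<longlongrightarrow> 0) at_top"
    "((\<lambda>x. of_real (sech x) * poly p (complex_of_real (tanh x)) * plane_wave k x) \<longlongrightarrow> 0) at_bot"
    by (simp_all only: tendsto_sech_poly_tanh)
qed (intro has_vector_derivative_sech_poly_tanh isCont_sech_poly_tanh integrable_sech_poly_tanh)+

section \<open>The source term, the resonance and the transform at the two frequencies\<close>

lemma cnj_tanh_wave_times_source:
  "cnj (tanh_wave k x) * complex_of_real (sech x * tanh x * (tanh x)\<^sup>2)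
   = of_real (sech x) * poly [:0, 0, 0, \<i> * of_real k, 1:] (of_real (tanh x)) * plane_wave (- k) x"
  by (simp add: tanh_wave_def cnj_plane_wave power2_eq_square algebra_simps)

text \<open>Conjugation replaces k by -k in the exponential, so it suffices to find P with (1 - t^2)
  P' - (i k + t) P = t^4 + i k t^3. A cubic does this.\<close>

lemma integral_tanh_wave_source:
  assumes "k\<^sup>2 = 3"
  shows "(LINT x|lborel.
    cnj (tanh_wave k x) * complex_of_real (sech x * tanh x * (tanh x)\<^sup>2)) = 0"
proof -
  let ?K = "complex_of_real k"
  have "?K * ?K = 3"
    using assms by (metis of_real_mult of_real_numeral power2_eq_square)
  \<comment> \<open>Simplified products nest to the right, so k^2 = 3 is also provided in the form
    that rewrites inside them.\<close>
  then have "?K * (?K * z) = 3 * z" for z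
    by (simp flip: mult.assoc)
  \<comment> \<open>Comparing coefficients from the top degree determines the polynomial; the constant term
    is then consistent exactly when \<open>k\<^sup>2 = 3\<close>.\<close>
  then have "[:1, 0, - 1:] * pderiv [:\<i> * ?K / 4, - 3/4, - \<i> * ?K / 4, - 1/4:]
      + [:\<i> * of_real (- k), - 1:] * [:\<i> * ?K / 4, - 3/4, - \<i> * ?K / 4, - 1/4:]
      = [:0, 0, 0, \<i> * ?K, 1:]"
    using \<open>?K * ?K = 3\<close> by (simp add: pderiv_pCons field_simps)
  with integral_sech_poly_tanh_exact[of "[:\<i> * ?K / 4, - 3/4, - \<i> * ?K / 4, - 1/4:]" "- k"]
  show ?thesis
    unfolding cnj_tanh_wave_times_source by metis
qed

text \<open>This is the case k = 0 of \<open>tanh_wave\<close>, where the plane wave is 1, carried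
  out over the reals: tanh'' = -2 sech^2 tanh.\<close>

lemma zero_energy_resonance_tanh:
  "zero_energy_resonance (\<lambda>x. - 2 * (sech x)\<^sup>2) tanh"
  unfolding zero_energy_resonance_def
proof (intro conjI)
  show "solves_schrodinger (\<lambda>x. - 2 * (sech x)\<^sup>2) 0 (tanh :: real \<Rightarrow> real)"
  proof (rule solves_schrodingerI)
    show "(tanh has_vector_derivative 1 - (tanh x)\<^sup>2) (at x)" for x :: real
      using has_real_derivative_tanh
      by (simp add: has_real_derivative_iff_has_vector_derivative)
    have "((\<lambda>x. 1 - (tanh x)\<^sup>2) has_real_derivative - 2 * (sech x)\<^sup>2 * tanh x) (at x)" for x :: real
      by (rule derivative_eq_intros has_real_derivative_tanh refl
          | simp add: sech_squared algebra_simps)+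
    then show "((\<lambda>x. 1 - (tanh x)\<^sup>2) has_vector_derivative - 2 * (sech x)\<^sup>2 * tanh x) (at x)"
      for x :: real
      by (simp add: has_real_derivative_iff_has_vector_derivative)
  qed simp
  show "bounded (range (tanh :: real \<Rightarrow> real))"
    using abs_tanh_le_1 by (auto simp: bounded_iff)
  show "\<exists>x::real. tanh x \<noteq> 0"
    by (rule exI[of _ 1]) simp
qed

theorem mainTheorem2:
  fixes V \<phi> \<alpha> :: "real \<Rightarrow> real" and g :: "real \<Rightarrow> complex"
  assumes "V = (\<lambda>x. - 2 * (sech x)\<^sup>2)"
    and "\<phi> = (\<lambda>x. tanh x)"
    and "\<alpha> = (\<lambda>x. sech x * tanh x)"
    and "g = (\<lambda>x. complex_of_real (\<alpha> x * (\<phi> x)\<^sup>2))"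
  shows "zero_energy_resonance V \<phi> \<and>
    (\<forall>\<xi>\<in>{sqrt 3, - sqrt 3}.
       integrable lborel (\<lambda>x. cnj (distorted_basis V x \<xi>) * g x) \<and>
       distorted_fourier V g \<xi> = 0)"
proof (intro conjI ballI)
  show "zero_energy_resonance V \<phi>"
    using zero_energy_resonance_tanh by (simp add: assms)
next
  fix \<xi> assume "\<xi> \<in> {sqrt 3, - sqrt 3}"
  then have \<xi>: "\<xi>\<^sup>2 = 3" "\<xi> \<noteq> 0" by auto
  obtain c where c: "\<And>x. distorted_basis V x \<xi> = c * tanh_wave \<xi> x"
    using distorted_basis_sech[OF \<xi>(2)] unfolding assms(1) by metis
  have eq: "cnj (distorted_basis V x \<xi>) * g x = cnj c *
      (cnj (tanh_wave \<xi> x) * complex_of_real (sech x * tanh x * (tanh x)\<^sup>2))" for x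
    unfolding c assms(2-4) complex_cnj_mult by (simp only: mult.assoc)
  \<comment> \<open>The Lebesgue integral of a non-integrable function is 0 by convention;
    integrability shows that the vanishing below is genuine.\<close>
  show "integrable lborel (\<lambda>x. cnj (distorted_basis V x \<xi>) * g x)"
    unfolding eq cnj_tanh_wave_times_source
    by (intro integrable_mult_right integrable_sech_poly_tanh)
  show "distorted_fourier V g \<xi> = 0"
    unfolding distorted_fourier_def eq integral_mult_right_zero integral_tanh_wave_source[OF \<xi>(1)]
    by simp
qed

end
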